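(* For every integer $s\ge1$, writing $G_m=G_m^{(s)}(y)$ and $H_k=H_k^{(s)}(y)$, as formal power series in $y$: $$H_0=\frac1{1-y},$$ $$H_1=G_1-\frac1{(1-y)^2},$$ $$H_2=G_2-\frac{d}{dy}(yG_1)+\frac{y}{(1-y)^3},$$ $$H_3=G_3-\frac{d}{dy}(yG_2)+\frac y2\frac{d^2}{dy^2}(yG_1)-\frac{y^2}{(1-y)^4},$$ $$H_4=G_4-\frac{d}{dy}(yG_3)+\frac y2\frac{d^2}{dy^2}(yG_2)-\frac{y^2}{6}\frac{d^3}{dy^3}(yG_1)+\frac{y^3}{(1-y)^5}.$$
   Context: For integers $d\ge2$ and $s\ge1$ let $$\mathcal P_d^{(s)}=\{x=(x_1,\dots,x_d)\in\mathbb R_{\ge0}^d:\ x_i+x_{i+1}\le s+\delta_i,\ 1\le i\le d-1\},$$ where $\delta_i=0$ for $i$ odd and $\delta_i=1$ for $i$ even; this is a lattice polytope. By convention $\mathcal P_0^{(s)}=\{0\}$ and $\mathcal P_1^{(s)}=[0,s]$. For $d\ge0$, $m\ge0$ let $L_d^{(s)}(m):=\#(m\mathcal P_d^{(s)}\cap\mathbb Z^d)$; in particular $L_0^{(s)}(m)=1$ and $L_1^{(s)}(m)=sm+1$, and $L_d^{(s)}(0)=1$. The $h^*$-polynomial $h_d^{(s)}(z)=\sum_{k=0}^d h_{d,k}^{(s)}z^k$ is defined by $$\sum_{m\ge0}L_d^{(s)}(m)z^m=\frac{h_d^{(s)}(z)}{(1-z)^{d+1}},$$ and $h_{d,k}^{(s)}:=0$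 for $k>d$. Define $G_m^{(s)}(y):=\sum_{d\ge0}L_d^{(s)}(m)\,y^d$ and $H_k^{(s)}(y):=\sum_{d\ge0}h_{d,k}^{(s)}\,y^d$. *)

theory Defs
  imports Complex_Main "HOL-Computational_Algebra.Computational_Algebra"
begin

definition delta :: "nat \<Rightarrow> nat" where
  "delta i = (if odd i then 0 else 1)"

(* A point of R^d is a function with coordinates x 1, ..., x d that is 0 at all other
   indices.  For d = 0 the set below is {0}.  For d = 1 there are no inequalities
   x i + x (i+1) <= s + delta i; the last conjunct is the convention P_1 = [0, s]. *)
definition zpolytope :: "nat \<Rightarrow> nat \<Rightarrow> (nat \<Rightarrow> real) set" where
  "zpolytope s d = {x. (\<forall>i. i \<notin> {1..d} \<longrightarrow> x i = 0) \<and>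
      (\<forall>i\<in>{1..d}. 0 \<le> x i) \<and>
      (\<forall>i\<in>{1..<d}. x i + x (i + 1) \<le> real (s + delta i)) \<and>
      (d = 1 \<longrightarrow> x 1 \<le> real s)}"

definition ehrhart :: "nat \<Rightarrow> nat \<Rightarrow> nat \<Rightarrow> nat" where
  "ehrhart s d m = card ((\<lambda>x i. real m * x i) ` zpolytope s d \<inter> {x. \<forall>i. x i \<in> \<int>})"

definition ehrhart_series :: "nat \<Rightarrow> nat \<Rightarrow> real fps" where
  "ehrhart_series s d = Abs_fps (\<lambda>m. real (ehrhart s d m))"

(* Uniqueness is clear because 1 - fps_X is a unit; existence is Ehrhart's theorem for
   the lattice polytope zpolytope s d. *)
definition hstar :: "nat \<Rightarrow> nat \<Rightarrow> real poly" where
  "hstar s d = (THE h. degree h \<le> d \<and>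
      ehrhart_series s d = fps_of_poly h / (1 - fps_X) ^ (d + 1))"

definition G :: "nat \<Rightarrow> nat \<Rightarrow> real fps" where
  "G s m = Abs_fps (\<lambda>d. real (ehrhart s d m))"

definition H :: "nat \<Rightarrow> nat \<Rightarrow> real fps" where
  "H s k = Abs_fps (\<lambda>d. poly.coeff (hstar s d) k)"

end

theory Submission
  imports Defs
begin

text \<open>
Multiplying the Ehrhart series of the $d$-dimensional polytope by $(1-z)^{d+1}$ and reading off
the coefficient of $z^k$ gives
$h_{d,k} = \sum_{j\le k} (-1)^j \binom{d+1}{j} L_d(k-j)$.
Summed over $d$, the factor $\binom{d+1}{j}$ with $j \ge 1$ is exactly what the operator
$g \mapsto \frac{y^{j-1}}{j!}\,\frac{d^j}{dy^j}(y g)$ does to the coefficients of $g$, and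
the term $j = k \ge 1$, where $L_d(0) = 1$, sums to $(-1)^k y^{k-1}/(1-y)^{k+1}$. So the
identities (and their analogues for every $k$) are comparisons of coefficients, once it is known that
the product of the Ehrhart series with $(1-z)^{d+1}$ really is a polynomial of degree at most $d$,
so that the description defining \<^const>\<open>hstar\<close> has a solution.

That last point is Ehrhart's theorem, and here it has an elementary proof. Let $N_d(m,t)$ count the
lattice points of the $m$-th dilate whose last coordinate is at most $t$. Removing the last
coordinate gives
$N_{d+1}(m,t) = \sum_{x \le \min(t, c_d m)} N_d(m, c_d m - x)$ with constant caps $c_d$. By
induction, on each block $jm \le t \le (j+1)m$ the number $N_d(m, jm+r)$ is a polynomial in $m$ and
$r$ of total degree at most $d$: reflecting $t$ in a multiple of $m$ and truncating $t$ at a multiple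
of $m$ permute or collapse the blocks, and summation raises the degree by one
(\<open>piecewise_binomial_span_card_path_points\<close>). Setting $r = 0$ in a suitable block, the number
$L_d(m)$ is a polynomial in $m$ of degree at most $d$. Polynomials are written in products of
binomial coefficients, because
summation in that basis is a shift of the lower index and $\sum_m \binom{m}{k} z^m$ is the monomial
$z^k$ over $(1-z)^{k+1}$.
\<close>

section \<open>Polynomials in the binomial basis\<close>

text \<open>
These are the real polynomial functions of two variables of total degree at most $e$, presented
by the basis in which sums and generating functions are easiest.
\<close>

inductive binomial_span :: "nat \<Rightarrow> (real \<Rightarrow> real \<Rightarrow> real) \<Rightarrow> bool" where
  monomial: "a + b \<le> e \<Longrightarrow> binomial_span e (\<lambda>m r. c * (m gchoose a) * (r gchoose b))"
| add: "binomial_span e f \<Longrightarrow> binomial_span e g \<Longrightarrow> binomial_span e (\<lambda>m r. f m r + g m r)"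

lemma binomial_span_scale: "binomial_span e f \<Longrightarrow> binomial_span e (\<lambda>m r. k * f m r)"
proof (induction rule: binomial_span.induct)
  case (monomial a b e c)
  then show ?case using binomial_span.monomial[of a b e "k * c"] by (simp add: mult.assoc)
next
  case (add e f g)
  then show ?case using binomial_span.add by (simp add: distrib_left)
qed

lemma binomial_span_mono: "binomial_span e f \<Longrightarrow> e \<le> e' \<Longrightarrow> binomial_span e' f"
  by (induction rule: binomial_span.induct) (auto intro: binomial_span.intros)

lemma binomial_span_const: "binomial_span e (\<lambda>m r. k)"
  using binomial_span.monomial[of 0 0 e k] by simp

lemma gbinomial_mult_self:
  fixes x :: real
  shows "x * (x gchoose k) = real (Suc k) * (x gchoose Suc k) + real k * (x gchoose k)"
  using gbinomial_mult_1[of x k] by simp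

text \<open>
Closure under multiplication by a variable is how the reflection below is expanded in the basis: it
turns the factor $x - k$ in $(k+1)\binom{x}{k+1} = (x-k)\binom{x}{k}$ into an operation of the span.
\<close>

lemma binomial_span_mult_snd: "binomial_span e f \<Longrightarrow> binomial_span (Suc e) (\<lambda>m r. r * f m r)"
proof (induction rule: binomial_span.induct)
  case (monomial a b e c)
  have eq: "(\<lambda>m r::real. r * (c * (m gchoose a) * (r gchoose b))) =
    (\<lambda>m r. (c * real (Suc b)) * (m gchoose a) * (r gchoose Suc b) +
      (c * real b) * (m gchoose a) * (r gchoose b))"
  proof (intro ext)
    fix m r :: real
    have "r * (c * (m gchoose a) * (r gchoose b)) = c * (m gchoose a) * (r * (r gchoose b))"
      by simp
    then show "r * (c * (m gchoose a) * (r gchoose b)) =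
      (c * real (Suc b)) * (m gchoose a) * (r gchoose Suc b) + (c * real b) * (m gchoose a) * (r gchoose b)"
      unfolding gbinomial_mult_self by (simp only: distrib_left mult_ac)
  qed
  show ?case unfolding eq
    by (intro binomial_span.intros) (use monomial in auto)
next
  case (add e f g)
  then show ?case using binomial_span.add by (simp add: distrib_left)
qed

lemma binomial_span_swap: "binomial_span e f \<Longrightarrow> binomial_span e (\<lambda>m r. f r m)"
proof (induction rule: binomial_span.induct)
  case (monomial a b e c)
  then show ?case using binomial_span.monomial[of b a e c] by (simp add: mult_ac)
qed (rule binomial_span.add)

lemma binomial_span_mult_fst: "binomial_span e f \<Longrightarrow> binomial_span (Suc e) (\<lambda>m r. m * f m r)"
  using binomial_span_swap[OF binomial_span_mult_snd[OF binomial_span_swap]] .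

text \<open>
On a block of length $m$, replacing $r$ by $m - r$ reverses the direction in which the block is
traversed. The total degree survives because $m$ and $r$ both count as degree one.
\<close>

lemma binomial_span_reflect: "binomial_span e f \<Longrightarrow> binomial_span e (\<lambda>m r. f m (m - r))"
proof (induction rule: binomial_span.induct)
  case (monomial a b e c)
  have "binomial_span (a + b) (\<lambda>m r. c * (m gchoose a) * (m - r gchoose b))"
  proof (induction b)
    case 0
    show ?case using binomial_span.monomial[of a 0 a c] by simp
  next
    case (Suc b)
    let ?f = "\<lambda>m r::real. c * (m gchoose a) * (m - r gchoose b)"
    have eq: "(\<lambda>m r::real. c * (m gchoose a) * (m - r gchoose Suc b)) =
      (\<lambda>m r. 1 / real (Suc b) * ((m * ?f m r + (-1) * (r * ?f m r)) + (- real b) * ?f m r))"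
    proof (intro ext)
      fix m r :: real
      have "(m - r gchoose Suc b) = 1 / real (Suc b) * ((m - r - real b) * (m - r gchoose b))"
        using gbinomial_mult_self[of "m - r" b] by (simp add: field_simps)
      then show "c * (m gchoose a) * (m - r gchoose Suc b) =
        1 / real (Suc b) * ((m * ?f m r + (-1) * (r * ?f m r)) + (- real b) * ?f m r)"
        by (subst \<open>(m - r gchoose Suc b) = _\<close>) (simp add: algebra_simps)
    qed
    show ?case unfolding eq add_Suc_right
      by (intro binomial_span_scale binomial_span.add binomial_span_mult_fst binomial_span_mult_snd
          binomial_span_mono[OF Suc, of "Suc (a + b)"] Suc) auto
  qed
  then show ?case using monomial by (rule binomial_span_mono)
qed (rule binomial_span.add)

lemma binomial_span_at_0: "binomial_span e f \<Longrightarrow> binomial_span e (\<lambda>m r. f m 0)"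
proof (induction rule: binomial_span.induct)
  case (monomial a b e c)
  then show ?case
    using binomial_span.monomial[of a 0 e c] binomial_span_const[of e 0] by (cases b) auto
qed (rule binomial_span.add)

lemma binomial_span_at_fst: "binomial_span e f \<Longrightarrow> binomial_span e (\<lambda>m r. f m m)"
  using binomial_span_at_0[OF binomial_span_reflect] by fastforce

lemma gbinomial_1_plus: "(1 + x gchoose Suc k) = (x gchoose k) + (x gchoose Suc k)" for x :: real
  using gbinomial_Suc_Suc[of x k] by (simp add: add.commute)

text \<open>The hockey-stick identity: summation in $r$ raises the lower index by one.\<close>

lemma binomial_span_sum:
  "binomial_span e f \<Longrightarrow> \<exists>g. binomial_span (Suc e) g \<and> (\<forall>m n. g m (real n) = (\<Sum>i<n. f m (real i)))"
proof (induction rule: binomial_span.induct)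
  case (monomial a b e c)
  have "binomial_span (Suc e) (\<lambda>m r. c * (m gchoose a) * (r gchoose Suc b))"
    by (rule binomial_span.monomial) (use monomial in simp)
  moreover have "(real n gchoose Suc b) = (\<Sum>i<n. (real i gchoose b))" for n
    by (induction n) (simp_all add: gbinomial_1_plus)
  ultimately show ?case by (fastforce simp: sum_distrib_left)
next
  case (add e f g)
  then obtain f' g' where
    "binomial_span (Suc e) f'" "\<forall>m n. f' m (real n) = (\<Sum>i<n. f m (real i))"
    "binomial_span (Suc e) g'" "\<forall>m n. g' m (real n) = (\<Sum>i<n. g m (real i))" by blast
  then show ?case
    by (intro exI[of _ "\<lambda>m r. f' m r + g' m r"]) (auto intro: binomial_span.add simp: sum.distrib)
qed

section \<open>Functions that are polynomial on blocks of length m\<close>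

text \<open>
Both endpoints $r = 0$ and $r = m$ belong to a block, so that neighbouring polynomials agree where
they meet and the reflection $r \mapsto m - r$ maps blocks onto blocks.
\<close>

definition piecewise_binomial_span :: "nat \<Rightarrow> (nat \<Rightarrow> nat \<Rightarrow> real) \<Rightarrow> bool" where
  "piecewise_binomial_span e f \<longleftrightarrow>
    (\<forall>j. \<exists>p. binomial_span e p \<and> (\<forall>m r. r \<le> m \<longrightarrow> f m (j * m + r) = p (real m) (real r)))"

lemma piecewise_binomial_spanE:
  assumes "piecewise_binomial_span e f"
  obtains p where "binomial_span e p" "\<And>m r. r \<le> m \<Longrightarrow> f m (j * m + r) = p (real m) (real r)"
  using assms unfolding piecewise_binomial_span_def by blast

lemma piecewise_binomial_span_at_multiple:
  assumes "piecewise_binomial_span e f"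
  obtains p where "binomial_span e p" "\<And>m r. f m (j * m) = p (real m) r"
proof -
  obtain p where "binomial_span e p"
    "\<And>m r. r \<le> m \<Longrightarrow> f m (j * m + r) = p (real m) (real r)"
    using piecewise_binomial_spanE[OF assms, of j] by blast
  then show ?thesis
    using that[of "\<lambda>m r. p m 0"] binomial_span_at_0 by (metis add.right_neutral le0 of_nat_0)
qed

lemma piecewise_binomial_span_truncate:
  assumes "piecewise_binomial_span e f"
  shows "piecewise_binomial_span e (\<lambda>m t. f m (min t (c * m)))"
  unfolding piecewise_binomial_span_def
proof
  fix j
  show "\<exists>p. binomial_span e p \<and> (\<forall>m r. r \<le> m \<longrightarrow> f m (min (j * m + r) (c * m)) = p (real m) (real r))"
  proof (cases "j < c")
    case True
    have "j * m + r \<le> c * m" if "r \<le> m" for m r :: nat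
      using mult_le_mono1[of "Suc j" c m] True that by simp
    then show ?thesis
      using assms unfolding piecewise_binomial_span_def by (simp add: min_def)
  next
    case False
    then have "min (j * m + r) (c * m) = c * m" for m r :: nat
      using False by (intro min_absorb2 trans_le_add1 mult_le_mono1) simp
    then show ?thesis
      using piecewise_binomial_span_at_multiple[OF assms, of c] by metis
  qed
qed

text \<open>
Reflection in $cm$ sends block $j < c$ to block $c - 1 - j$. Blocks beyond $cm$ are sent to the point
$0$ by truncated subtraction, so the function is constant in $r$ there.
\<close>

lemma piecewise_binomial_span_reflect:
  assumes "piecewise_binomial_span e f"
  shows "piecewise_binomial_span e (\<lambda>m t. f m (c * m - t))"
  unfolding piecewise_binomial_span_def
proof
  fix j
  show "\<exists>p. binomial_span e p \<and> (\<forall>m r. r \<le> m \<longrightarrow> f m (c * m - (j * m + r)) = p (real m) (real r))"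
  proof (cases "j < c")
    case True
    then obtain i where c: "c = Suc (j + i)"
      using less_imp_Suc_add by blast
    obtain p where p: "binomial_span e p" "\<And>m r. r \<le> m \<Longrightarrow> f m (i * m + r) = p (real m) (real r)"
      using piecewise_binomial_spanE[OF assms, of i] by blast
    have "f m (c * m - (j * m + r)) = p (real m) (real m - real r)" if "r \<le> m" for m r
    proof -
      have "c * m - (j * m + r) = i * m + (m - r)"
        using that by (simp add: c algebra_simps)
      then show ?thesis using p(2)[of "m - r" m] that by (simp add: of_nat_diff)
    qed
    then show ?thesis using binomial_span_reflect[OF p(1)] by blast
  next
    case False
    then have "c * m - (j * m + r) = 0 * m" for m r :: nat
      by (simp add: trans_le_add1)
    then show ?thesis
      using piecewise_binomial_span_at_multiple[OF assms, of 0] by metis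
  qed
qed

text \<open>
A sum up to $jm + r$ consists of $j$ complete blocks, each of which contributes a polynomial in $m$
alone, and an initial part of block $j$. Strict upper bounds keep a common endpoint of two blocks from
being counted twice; the last summand is added separately.
\<close>

lemma piecewise_binomial_span_sum:
  assumes "piecewise_binomial_span e f"
  shows "piecewise_binomial_span (Suc e) (\<lambda>m t. \<Sum>x\<le>t. f m x)"
proof -
  have split: "(\<Sum>x<a + b. g x) = (\<Sum>x<a. g x) + (\<Sum>x<b. g (a + x))"
    for a b :: nat and g :: "nat \<Rightarrow> real"
    by (induction b) (simp_all add: add.assoc)
  have block: "\<exists>q. binomial_span (Suc e) q \<and>
      (\<forall>m r. r \<le> m \<longrightarrow> (\<Sum>x<r. f m (j * m + x)) = q (real m) (real r))" for j
  proof -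
    obtain p where p: "binomial_span e p" "\<And>m r. r \<le> m \<Longrightarrow> f m (j * m + r) = p (real m) (real r)"
      using piecewise_binomial_spanE[OF assms, of j] by blast
    obtain q where "binomial_span (Suc e) q" "\<forall>m n. q m (real n) = (\<Sum>i<n. p m (real i))"
      using binomial_span_sum[OF p(1)] by blast
    with p(2) show ?thesis by (intro exI[of _ q]) auto
  qed
  have strict: "\<exists>q. binomial_span (Suc e) q \<and>
      (\<forall>m r. r \<le> m \<longrightarrow> (\<Sum>x<j * m + r. f m x) = q (real m) (real r))" for j
  proof (induction j)
    case 0
    show ?case using block[of 0] by simp
  next
    case (Suc j)
    then obtain q where q: "binomial_span (Suc e) q"
      "\<And>m r. r \<le> m \<Longrightarrow> (\<Sum>x<j * m + r. f m x) = q (real m) (real r)" by blast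
    obtain q' where q': "binomial_span (Suc e) q'"
      "\<And>m r. r \<le> m \<Longrightarrow> (\<Sum>x<r. f m (Suc j * m + x)) = q' (real m) (real r)"
      using block[of "Suc j"] by blast
    have "(\<Sum>x<Suc j * m + r. f m x) = q (real m) (real m) + q' (real m) (real r)"
      if "r \<le> m" for m r
      using q(2)[of m m] q'(2)[OF that] split[of "f m" "Suc j * m" r]
      by (simp add: add.commute)
    then show ?case
      using binomial_span.add[OF binomial_span_at_fst[OF q(1)] q'(1)]
      by (intro exI[of _ "\<lambda>m r. q m m + q' m r"]) blast
  qed
  show ?thesis unfolding piecewise_binomial_span_def
  proof
    fix j
    obtain q where q: "binomial_span (Suc e) q"
      "\<And>m r. r \<le> m \<Longrightarrow> (\<Sum>x<j * m + r. f m x) = q (real m) (real r)"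
      using strict by blast
    obtain p where p: "binomial_span e p" "\<And>m r. r \<le> m \<Longrightarrow> f m (j * m + r) = p (real m) (real r)"
      using piecewise_binomial_spanE[OF assms, of j] by blast
    have "binomial_span (Suc e) p" using p(1) by (rule binomial_span_mono) simp
    from binomial_span.add[OF q(1) this]
    show "\<exists>p. binomial_span (Suc e) p \<and>
      (\<forall>m r. r \<le> m \<longrightarrow> (\<Sum>x\<le>j * m + r. f m x) = p (real m) (real r))"
      by (intro exI[of _ "\<lambda>m r. q m r + p m r"])
        (simp add: q(2) p(2) lessThan_Suc_atMost[symmetric])
  qed
qed

section \<open>Lattice points of path polytopes\<close>

text \<open>
The lattice points of the $m$-th dilate of $\{x \ge 0 : x_i + x_{i+1} \le c_i,\ 0 \le i < d\}$ with
$x_0 = 0$ and last coordinate at most $t$. The fictitious coordinate $x_0$ makes the bound on $x_1$ an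
instance of the general inequality; the bound $t$ is what allows a recursion on $d$.
\<close>

definition path_points :: "(nat \<Rightarrow> nat) \<Rightarrow> nat \<Rightarrow> nat \<Rightarrow> nat \<Rightarrow> (nat \<Rightarrow> nat) set" where
  "path_points c d m t = {z. (\<forall>i. i \<notin> {1..d} \<longrightarrow> z i = 0) \<and>
     (\<forall>i<d. z i + z (Suc i) \<le> c i * m) \<and> z d \<le> t}"

lemma path_points_0: "path_points c 0 m t = {\<lambda>_. 0}"
  by (auto simp: path_points_def)

lemma path_points_Suc:
  "path_points c (Suc d) m t =
    (\<Union>x\<le>min t (c d * m). (\<lambda>z. z(Suc d := x)) ` path_points c d m (c d * m - x))"
proof (intro equalityI subsetI)
  fix z assume z: "z \<in> path_points c (Suc d) m t"
  then have le: "z d + z (Suc d) \<le> c d * m" "z (Suc d) \<le> t"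
    by (auto simp: path_points_def)
  have "z(Suc d := 0) \<in> path_points c d m (c d * m - z (Suc d))"
    using z le by (auto simp: path_points_def less_Suc_eq)
  then have "z \<in> (\<lambda>y. y(Suc d := z (Suc d))) ` path_points c d m (c d * m - z (Suc d))"
    by (intro image_eqI[of _ _ "z(Suc d := 0)"]) auto
  then show "z \<in> (\<Union>x\<le>min t (c d * m). (\<lambda>z. z(Suc d := x)) ` path_points c d m (c d * m - x))"
    using le by (intro UN_I[of "z (Suc d)"]) auto
next
  fix z
  assume "z \<in> (\<Union>x\<le>min t (c d * m). (\<lambda>z. z(Suc d := x)) ` path_points c d m (c d * m - x))"
  then obtain x y where "x \<le> t" "x \<le> c d * m" "y \<in> path_points c d m (c d * m - x)"
    "z = y(Suc d := x)" by auto
  then show "z \<in> path_points c (Suc d) m t"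
    by (auto simp: path_points_def less_Suc_eq)
qed

lemma finite_path_points: "finite (path_points c d m t)"
  by (induction d arbitrary: t) (simp_all add: path_points_0 path_points_Suc)

lemma card_path_points_Suc:
  "card (path_points c (Suc d) m t) =
    (\<Sum>x\<le>min t (c d * m). card (path_points c d m (c d * m - x)))"
proof -
  have inj: "inj_on (\<lambda>z. z(Suc d := x)) (path_points c d m t')" for x t'
  proof (rule inj_onI)
    fix y z assume yz: "y \<in> path_points c d m t'" "z \<in> path_points c d m t'"
      and eq: "y(Suc d := x) = z(Suc d := x)"
    have "y i = z i" for i
      using yz fun_cong[OF eq, of i] by (cases "i = Suc d") (auto simp: path_points_def)
    then show "y = z" by blast
  qed
  show ?thesis unfolding path_points_Suc
    by (subst card_UN_disjoint)
      (auto simp: finite_path_points card_image[OF inj] dest: fun_cong[where x = "Suc d"])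
qed

text \<open>
The recursion for the cardinality composes a reflection, a sum and a truncation, and only the sum
raises the degree.
\<close>

lemma piecewise_binomial_span_card_path_points:
  "piecewise_binomial_span d (\<lambda>m t. real (card (path_points c d m t)))"
proof (induction d)
  case 0
  show ?case
    using binomial_span_const[of 0 1] by (auto simp: piecewise_binomial_span_def path_points_0)
next
  case (Suc d)
  show ?case
    using piecewise_binomial_span_truncate[OF piecewise_binomial_span_sum[OF piecewise_binomial_span_reflect[OF Suc]],
        of "c d" "c d"]
    by (simp add: card_path_points_Suc)
qed

section \<open>The Ehrhart series is a polynomial over a power of 1 - z\<close>

text \<open>
The value $s$ at index $0$ expresses $x_1 \le s$. This is the convention in dimension one, and a
consequence of $x_1 + x_2 \le s$ in higher dimension.
\<close>

definition cap :: "nat \<Rightarrow> nat \<Rightarrow> nat" where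
  "cap s i = (if i = 0 then s else s + delta i)"

lemma zpolytope_iff_cap:
  "x \<in> zpolytope s d \<longleftrightarrow> (\<forall>i. i \<notin> {1..d} \<longrightarrow> x i = 0) \<and> (\<forall>i. 0 \<le> x i) \<and>
     (\<forall>i<d. x i + x (Suc i) \<le> real (cap s i))" (is "?L \<longleftrightarrow> ?R")
proof
  assume L: ?L
  have zero: "x i = 0" if "i \<notin> {1..d}" for i
    using L that by (auto simp: zpolytope_def)
  have nonneg: "0 \<le> x i" for i
    using L zero[of i] by (cases "i \<in> {1..d}") (auto simp: zpolytope_def)
  have "x i + x (Suc i) \<le> real (cap s i)" if i: "i < d" for i
  proof (cases "i = 0")
    case False
    then show ?thesis using L i by (auto simp: zpolytope_def cap_def)
  next
    case True
    have "x 1 \<le> real s"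
    proof (cases "d = 1")
      case True
      then show ?thesis using L by (auto simp: zpolytope_def)
    next
      case False
      then have "x 1 + x (1 + 1) \<le> real (s + delta 1)"
        using L i by (auto simp: zpolytope_def)
      then show ?thesis using nonneg[of 2] by (simp add: delta_def numeral_2_eq_2)
    qed
    then show ?thesis using True zero[of 0] by (simp add: cap_def)
  qed
  then show ?R using zero nonneg by blast
next
  assume R: ?R
  have 1: "x i + x (i + 1) \<le> real (s + delta i)" if "i \<in> {1..<d}" for i
    using R that by (auto simp: cap_def dest!: spec[of _ i])
  have 2: "x 1 \<le> real s" if "d = 1"
  proof -
    have "x 0 + x (Suc 0) \<le> real (cap s 0)" "x 0 = 0" using R that by auto
    then show ?thesis by (simp add: cap_def)
  qed
  show ?L using R 1 2 by (auto simp: zpolytope_def)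
qed

text \<open>
Since no cap exceeds $s + 1$, the bound $(s + 1)m$ on the last coordinate is vacuous; as a multiple of
$m$ it is the start of a block. For $m = 0$ both sides count only the origin.
\<close>

lemma ehrhart_eq_card_path_points:
  "ehrhart s d m = card (path_points (cap s) d m ((s + 1) * m))"
proof -
  have "(\<lambda>x i. real m * x i) ` zpolytope s d \<inter> {x. \<forall>i. x i \<in> \<int>} =
    (\<lambda>z i. real (z i)) ` path_points (cap s) d m ((s + 1) * m)" (is "?A = ?B")
  proof (intro equalityI subsetI)
    fix y assume "y \<in> ?A"
    then obtain x where x: "x \<in> zpolytope s d" and y: "y = (\<lambda>i. real m * x i)"
      and int: "\<And>i. y i \<in> \<int>" by auto
    have nonneg: "0 \<le> y i" for i using x by (simp add: y zpolytope_iff_cap)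
    define z where "z = (\<lambda>i. nat \<lfloor>y i\<rfloor>)"
    have yz: "y i = real (z i)" for i
      using int[of i] nonneg[of i] by (auto simp: z_def elim!: Ints_cases)
    have zero: "z i = 0" if "i \<notin> {1..d}" for i
      using x that yz[of i] by (simp add: y zpolytope_iff_cap)
    have sum: "z i + z (Suc i) \<le> cap s i * m" if "i < d" for i
    proof -
      have "real m * (x i + x (Suc i)) \<le> real m * real (cap s i)"
        using x that by (intro mult_left_mono) (auto simp: zpolytope_iff_cap)
      then have "real (z i + z (Suc i)) \<le> real (cap s i * m)"
        using yz[of i] yz[of "Suc i"] by (simp add: y algebra_simps)
      then show ?thesis by linarith
    qed
    have "z d \<le> (s + 1) * m"
    proof (cases d)
      case 0
      then show ?thesis using zero[of 0] by simp
    next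
      case (Suc k)
      have "cap s k * m \<le> (s + 1) * m"
        by (intro mult_le_mono1) (simp add: cap_def delta_def)
      moreover have "z d \<le> cap s k * m"
        using sum[of k] Suc by simp
      ultimately show ?thesis by linarith
    qed
    then have "z \<in> path_points (cap s) d m ((s + 1) * m)"
      using zero sum by (simp add: path_points_def)
    moreover have "y = (\<lambda>i. real (z i))" using yz by blast
    ultimately show "y \<in> ?B" by blast
  next
    fix y assume "y \<in> ?B"
    then obtain z where z: "z \<in> path_points (cap s) d m ((s + 1) * m)"
      and y: "y = (\<lambda>i. real (z i))" by blast
    \<comment> \<open>For $m = 0$ this is the origin, whose dilate is \<open>y\<close> because all coordinates of \<open>z\<close> vanish.\<close>
    define x where "x = (\<lambda>i. y i / real m)"
    have "y i = real m * x i" for i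
    proof (cases "m = 0")
      case True
      have "z i = 0"
      proof (cases "i \<in> {1..d}")
        case False
        then show ?thesis using z by (simp add: path_points_def)
      next
        case in_range: True
        then have "z (i - 1) + z (Suc (i - 1)) \<le> cap s (i - 1) * m"
          using z by (auto simp: path_points_def simp del: Suc_pred dest!: spec[of _ "i - 1"])
        then show ?thesis using True in_range by simp
      qed
      then show ?thesis using True by (simp add: y)
    qed (simp add: x_def)
    moreover have "x \<in> zpolytope s d"
      unfolding zpolytope_iff_cap
    proof (intro conjI allI impI)
      fix i assume "i < d"
      then have "real (z i + z (Suc i)) \<le> real (cap s i * m)"
        using z unfolding path_points_def of_nat_le_iff by blast
      then show "x i + x (Suc i) \<le> real (cap s i)"
        by (cases "m = 0") (auto simp: x_def y field_simps)
    qed (use z in \<open>auto simp: x_def y path_points_def\<close>)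
    moreover have "y i \<in> \<int>" for i by (simp add: y)
    ultimately show "y \<in> ?A" by blast
  qed
  moreover have "inj_on (\<lambda>z i. real (z i)) (path_points (cap s) d m ((s + 1) * m))"
    by (rule inj_onI) (metis of_nat_eq_iff ext)
  ultimately show ?thesis by (simp add: ehrhart_def card_image)
qed

lemma ehrhart_0: "ehrhart s d 0 = 1"
proof -
  have "(\<lambda>i. 0) \<in> zpolytope s d" by (simp add: zpolytope_iff_cap)
  then have "(\<lambda>x i. real 0 * x i) ` zpolytope s d \<inter> {x. \<forall>i. x i \<in> \<int>} = {\<lambda>i. 0}"
    by auto
  then show ?thesis by (simp add: ehrhart_def)
qed

lemma binomial_column_series:
  "Abs_fps (\<lambda>m. real m gchoose k) * (1 - fps_X) ^ Suc k = fps_X ^ k"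
proof (induction k)
  case 0
  show ?case by (rule fps_ext) (simp add: algebra_simps)
next
  case (Suc k)
  have "Abs_fps (\<lambda>m. real m gchoose Suc k) * (1 - fps_X) = fps_X * Abs_fps (\<lambda>m. real m gchoose k)"
  proof (rule fps_ext)
    fix n
    show "(Abs_fps (\<lambda>m. real m gchoose Suc k) * (1 - fps_X)) $ n =
      (fps_X * Abs_fps (\<lambda>m. real m gchoose k)) $ n"
      by (cases n) (simp_all add: algebra_simps gbinomial_1_plus)
  qed
  then show ?case using Suc by (simp add: mult.assoc power_Suc) (metis mult.assoc mult.left_commute)
qed

lemma binomial_span_series:
  "binomial_span e f \<Longrightarrow> \<exists>h. degree h \<le> e \<and>
    Abs_fps (\<lambda>m. f (real m) 0) * (1 - fps_X) ^ Suc e = fps_of_poly h"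
proof (induction rule: binomial_span.induct)
  case (monomial a b e c)
  let ?k = "c * (0 gchoose b)"
  have "Abs_fps (\<lambda>m. c * (real m gchoose a) * (0 gchoose b)) * (1 - fps_X) ^ Suc e =
    fps_const ?k * (Abs_fps (\<lambda>m. real m gchoose a) * (1 - fps_X) ^ Suc a) * (1 - fps_X) ^ (e - a)"
  proof -
    have "Suc e = Suc a + (e - a)" using monomial by simp
    then have "(1 - fps_X :: real fps) ^ Suc e = (1 - fps_X) ^ Suc a * (1 - fps_X) ^ (e - a)"
      by (metis power_add)
    moreover have "Abs_fps (\<lambda>m. c * (real m gchoose a) * (0 gchoose b)) =
      fps_const ?k * Abs_fps (\<lambda>m. real m gchoose a)"
      by (rule fps_ext) simp
    ultimately show ?thesis by (simp only: mult.assoc)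
  qed
  also have "\<dots> = fps_of_poly ([:?k:] * monom 1 a * [:1, -1:] ^ (e - a))"
    unfolding binomial_column_series
    by (simp add: fps_of_poly_mult fps_of_poly_power fps_of_poly_monom fps_of_poly_pCons fps_of_poly_const)
  finally show ?case
  proof (intro exI conjI)
    have "degree ([:?k:] * monom 1 a * [:1, -1:] ^ (e - a)) \<le>
      degree ([:?k:] * monom (1::real) a) + degree ([:1, -1::real:] ^ (e - a))"
      by (rule degree_mult_le)
    also have "\<dots> \<le> a + (e - a)"
      by (intro add_mono order.trans[OF degree_mult_le])
        (auto simp: degree_monom_eq degree_linear_power intro: order.trans[OF degree_power_le])
    finally show "degree ([:?k:] * monom 1 a * [:1, -1:] ^ (e - a)) \<le> e"
      using monomial by simp
  qed
next
  case (add e f g)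
  then obtain p q where "degree p \<le> e" "degree q \<le> e"
    "Abs_fps (\<lambda>m. f (real m) 0) * (1 - fps_X) ^ Suc e = fps_of_poly p"
    "Abs_fps (\<lambda>m. g (real m) 0) * (1 - fps_X) ^ Suc e = fps_of_poly q" by blast
  moreover have "Abs_fps (\<lambda>m. f (real m) 0 + g (real m) 0) =
    Abs_fps (\<lambda>m. f (real m) 0) + Abs_fps (\<lambda>m. g (real m) 0)"
    by (rule fps_ext) simp
  ultimately show ?case
    by (intro exI[of _ "p + q"]) (simp add: degree_add_le distrib_right fps_of_poly_add)
qed

lemma eq_divide_one_minus_fps_X_power_iff:
  "E = F / (1 - fps_X) ^ n \<longleftrightarrow> E * (1 - fps_X) ^ n = F" for E F :: "real fps"
proof -
  have unit: "((1 - fps_X :: real fps) ^ n) $ 0 \<noteq> 0" by (simp add: fps_nth_power_0)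
  then have "(1 - fps_X :: real fps) ^ n dvd F" "(1 - fps_X :: real fps) ^ n \<noteq> 0"
    by (auto intro: unit_imp_dvd simp: fps_is_unit_iff)
  then show ?thesis by auto
qed

text \<open>
Here the existence half of the definite description in \<^const>\<open>hstar\<close> is discharged; afterwards only
this equation is used.
\<close>

lemma fps_of_poly_hstar:
  "fps_of_poly (hstar s d) = ehrhart_series s d * (1 - fps_X) ^ (d + 1)"
proof -
  obtain p where p: "binomial_span d p"
    "\<And>m r. real (card (path_points (cap s) d m ((s + 1) * m))) = p (real m) r"
    using piecewise_binomial_span_at_multiple[OF piecewise_binomial_span_card_path_points] by metis
  have "ehrhart_series s d = Abs_fps (\<lambda>m. p (real m) 0)"
    unfolding ehrhart_series_def ehrhart_eq_card_path_points p(2)[of _ 0] ..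
  then obtain h where h: "degree h \<le> d"
    "ehrhart_series s d * (1 - fps_X) ^ (d + 1) = fps_of_poly h"
    using binomial_span_series[OF p(1)] by auto
  have "hstar s d = h" unfolding hstar_def
    by (rule the_equality) (use h in \<open>auto simp: eq_divide_one_minus_fps_X_power_iff simp del: power_Suc\<close>)
  then show ?thesis using h by simp
qed

section \<open>Comparison of coefficients\<close>

lemma one_minus_fps_X_power_nth:
  "((1 - fps_X :: real fps) ^ n) $ j = (-1) ^ j * real (n choose j)"
proof (induction n arbitrary: j)
  case 0
  show ?case by simp
next
  case (Suc n)
  show ?case by (cases j) (simp_all add: left_diff_distrib distrib_left Suc)
qed

lemma H_nth:
  "H s k $ d = (\<Sum>j\<le>k. (-1) ^ j * real ((d + 1) choose j) * (G s (k - j) $ d))"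
proof -
  have "H s k $ d = (ehrhart_series s d * (1 - fps_X) ^ (d + 1)) $ k"
    unfolding fps_of_poly_hstar[symmetric] by (simp add: H_def)
  also have "\<dots> = (\<Sum>j\<le>k. (-1) ^ j * real ((d + 1) choose j) * (G s (k - j) $ d))"
    unfolding mult.commute[of "ehrhart_series s d"] fps_mult_nth one_minus_fps_X_power_nth
    by (simp add: atLeast0AtMost ehrhart_series_def G_def)
  finally show ?thesis .
qed

lemma fps_deriv_funpow_nth:
  fixes f :: "real fps"
  shows "fact n * (fps_deriv ^^ j) f $ n = fact (n + j) * f $ (n + j)"
proof (induction j arbitrary: n)
  case (Suc j)
  have "fact n * (fps_deriv ^^ Suc j) f $ n = fact (Suc n) * (fps_deriv ^^ j) f $ Suc n"
    by (simp add: algebra_simps)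
  then show ?case using Suc[of "Suc n"] by (simp add: mult_ac)
qed simp

text \<open>
Differentiating $y^{d+1}$ exactly $j+1$ times produces the falling factorial
$(d+1)d\cdots(d+1-j) = (j+1)!\binom{d+1}{j+1}$, and the power $y^j$ restores the exponent $d$. For
$d < j$ both sides vanish.
\<close>

lemma scaled_deriv_fps_X_mult_nth:
  fixes g :: "real fps"
  shows "(fps_X ^ j * (fps_deriv ^^ Suc j) (fps_X * g)) $ d =
    fact (Suc j) * real ((d + 1) choose Suc j) * g $ d"
proof (cases "d < j")
  case True
  then show ?thesis by (simp add: fps_X_power_mult_nth binomial_eq_0)
next
  case False
  then obtain n where d: "d = j + n" using le_Suc_ex not_less by blast
  have "fact (Suc j) * fact n * real ((d + 1) choose Suc j) = (fact (d + 1) :: real)"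
    using arg_cong[OF binomial_fact_lemma[of "Suc j" "d + 1"], of real]
    by (simp add: d del: fact_Suc binomial_Suc_Suc)
  then have "fact n * (fps_deriv ^^ Suc j) (fps_X * g) $ n =
      fact n * (fact (Suc j) * real ((d + 1) choose Suc j) * g $ d)"
    unfolding fps_deriv_funpow_nth
    by (simp add: d mult_ac add.commute[of n] flip: \<open>_ = (fact (d + 1) :: real)\<close>
        del: fact_Suc binomial_Suc_Suc)
  then have "(fps_deriv ^^ Suc j) (fps_X * g) $ n =
      fact (Suc j) * real ((d + 1) choose Suc j) * g $ d"
    by (metis fact_nonzero mult_left_cancel)
  then show ?thesis by (simp add: fps_X_power_mult_nth d del: fact_Suc funpow.simps)
qed

text \<open>
Column $j+1$ of Pascal's triangle starts with a zero, so its generating function can be divided by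
the variable; the quotient is the contribution of $L_d(0) = 1$.
\<close>

lemma shifted_binomial_series:
  "(fps_X ^ j / (1 - fps_X) ^ (j + 2) :: real fps) $ d = real ((d + 1) choose Suc j)"
proof -
  have "fps_X * Abs_fps (\<lambda>d. real ((d + 1) choose Suc j)) = Abs_fps (\<lambda>m. real m gchoose Suc j)"
  proof (rule fps_ext)
    fix n show "(fps_X * Abs_fps (\<lambda>d. real ((d + 1) choose Suc j))) $ n =
      Abs_fps (\<lambda>m. real m gchoose Suc j) $ n"
      by (cases n) (simp_all add: binomial_gbinomial gbinomial_1_plus)
  qed
  then have "fps_X * (Abs_fps (\<lambda>d. real ((d + 1) choose Suc j)) * (1 - fps_X) ^ (j + 2)) =
      fps_X * fps_X ^ j"
    using binomial_column_series[of "Suc j"] by (simp add: mult.assoc[symmetric])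
  then have "Abs_fps (\<lambda>d. real ((d + 1) choose Suc j)) = fps_X ^ j / (1 - fps_X) ^ (j + 2)"
    unfolding eq_divide_one_minus_fps_X_power_iff by (simp only: mult_left_cancel[OF fps_X_neq_zero])
  then show ?thesis by (metis fps_nth_Abs_fps)
qed

theorem proposition3p9:
  fixes s :: nat
  assumes "s \<ge> 1"
  shows "H s 0 = 1 / (1 - fps_X) \<and>
    H s 1 = G s 1 - 1 / (1 - fps_X) ^ 2 \<and>
    H s 2 = G s 2 - fps_deriv (fps_X * G s 1) + fps_X / (1 - fps_X) ^ 3 \<and>
    H s 3 = G s 3 - fps_deriv (fps_X * G s 2)
      + fps_X / 2 * (fps_deriv ^^ 2) (fps_X * G s 1)
      - fps_X ^ 2 / (1 - fps_X) ^ 4 \<and>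
    H s 4 = G s 4 - fps_deriv (fps_X * G s 3)
      + fps_X / 2 * (fps_deriv ^^ 2) (fps_X * G s 2)
      - fps_X ^ 2 / 6 * (fps_deriv ^^ 3) (fps_X * G s 1)
      + fps_X ^ 3 / (1 - fps_X) ^ 5"
proof -
  have G0: "G s 0 $ d = 1" for d by (simp add: G_def ehrhart_0)
  have scaled: "(f / numeral n * g) $ d = (f * g) $ d / numeral n" for f g :: "real fps" and n d
  proof -
    have "f / numeral n = fps_const (1 / numeral n) * f"
      unfolding numeral_fps_const divide_fps_const by (simp add: inverse_eq_divide)
    then show ?thesis by (simp add: mult.assoc)
  qed
  have op1: "fps_deriv (fps_X * g) $ d = real ((d + 1) choose 1) * g $ d" for g :: "real fps" and d
    using scaled_deriv_fps_X_mult_nth[of 0 g d] by simp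
  have op2: "(fps_X / 2 * (fps_deriv ^^ 2) (fps_X * g)) $ d = real ((d + 1) choose 2) * g $ d"
    for g :: "real fps" and d
    using scaled_deriv_fps_X_mult_nth[of 1 g d] by (simp add: scaled numeral_2_eq_2 del: funpow.simps)
  have op3: "(fps_X ^ 2 / 6 * (fps_deriv ^^ 3) (fps_X * g)) $ d = real ((d + 1) choose 3) * g $ d"
    for g :: "real fps" and d
    using scaled_deriv_fps_X_mult_nth[of 2 g d]
    by (simp add: scaled numeral_3_eq_3[symmetric] eval_nat_numeral(3)[symmetric] fact_numeral
        del: funpow.simps fps_mult_nth)
  have ser0: "(1 / (1 - fps_X) :: real fps) $ d = 1" for d
  proof -
    have "Abs_fps (\<lambda>m. real m gchoose 0) = 1 / (1 - fps_X) ^ 1"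
      unfolding eq_divide_one_minus_fps_X_power_iff using binomial_column_series[of 0] by simp
    then show ?thesis by (metis fps_nth_Abs_fps gbinomial_0(1) power_one_right)
  qed
  have ser1: "(1 / (1 - fps_X) ^ 2 :: real fps) $ d = real ((d + 1) choose 1)" for d
    using shifted_binomial_series[of 0 d] by (simp add: numeral_2_eq_2)
  have ser2: "(fps_X / (1 - fps_X) ^ 3 :: real fps) $ d = real ((d + 1) choose 2)" for d
    using shifted_binomial_series[of 1 d] by (simp add: eval_nat_numeral(2,3))
  have ser3: "(fps_X ^ 2 / (1 - fps_X) ^ 4 :: real fps) $ d = real ((d + 1) choose 3)" for d
    using shifted_binomial_series[of 2 d] by (simp add: eval_nat_numeral(2,3))
  have ser4: "(fps_X ^ 3 / (1 - fps_X) ^ 5 :: real fps) $ d = real ((d + 1) choose 4)" for d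
    using shifted_binomial_series[of 3 d] by (simp add: eval_nat_numeral(2,3))
  have sums: "(\<Sum>j\<le>1. f j) = f 0 + f 1" "(\<Sum>j\<le>2. f j) = f 0 + f 1 + f 2"
    "(\<Sum>j\<le>3. f j) = f 0 + f 1 + f 2 + f 3" "(\<Sum>j\<le>4. f j) = f 0 + f 1 + f 2 + f 3 + f 4"
    for f :: "nat \<Rightarrow> real"
    by (simp_all add: numeral_eq_Suc)
  note coeffs = H_nth sums op1 op2 op3 ser0 ser1 ser2 ser3 ser4 fps_add_nth fps_sub_nth
  have "H s 0 = 1 / (1 - fps_X)"
    by (rule fps_ext, simp only: coeffs) (simp add: G0 algebra_simps)
  moreover have "H s 1 = G s 1 - 1 / (1 - fps_X) ^ 2"
    by (rule fps_ext, simp only: coeffs) (simp add: G0 algebra_simps)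
  moreover have "H s 2 = G s 2 - fps_deriv (fps_X * G s 1) + fps_X / (1 - fps_X) ^ 3"
    by (rule fps_ext, simp only: coeffs) (simp add: G0 algebra_simps)
  moreover have "H s 3 = G s 3 - fps_deriv (fps_X * G s 2)
      + fps_X / 2 * (fps_deriv ^^ 2) (fps_X * G s 1) - fps_X ^ 2 / (1 - fps_X) ^ 4"
    by (rule fps_ext, simp only: coeffs) (simp add: G0 algebra_simps)
  moreover have "H s 4 = G s 4 - fps_deriv (fps_X * G s 3)
      + fps_X / 2 * (fps_deriv ^^ 2) (fps_X * G s 2)
      - fps_X ^ 2 / 6 * (fps_deriv ^^ 3) (fps_X * G s 1) + fps_X ^ 3 / (1 - fps_X) ^ 5"
    by (rule fps_ext, simp only: coeffs) (simp add: G0 algebra_simps)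
  ultimately show ?thesis by blast
qed

end
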